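(* Let $\Omega\subset\mathbb{C}$ be a non-empty, open and relatively compact set. Let $w\in A(\Omega)$ be such that $\inf_{z\in\overline{\Omega}}|w(z)|>0$. Define $\omega:=w|_\Omega$. Then the multiplication operator $$M_\omega:\varphi\in H^\infty(\Omega)\mapsto\varphi\cdot\omega\in H^\infty(\Omega)$$ is an invertible operator, and the following assertions are equivalent: \begin{itemize} \item[(a)] $M_\omega$ has the shadowing property; \item[(b)] $|w(z)|\neq1$ for all $z\in\overline{\Omega}$. \end{itemize} If, in addition, $\Omega$ is connected, then $M_\omega$ has the shadowing property if and only if it is hyperbolic.
   Context: $A(\Omega)$ is the space of continuous functions $\varphi:\overline{\Omega}\to\mathbb{C}$ whose restriction to $\Omega$ is holomorphic. $H^\infty(\Omega)$ is the Banach space of bounded holomorphic functions $\varphi:\Omega\to\mathbb{C}$ with the supremum norm. An (invertible) operator on a Banach space is a continuous (invertible) linear self-map. An operator $T$ is hyperbolic if $\sigma(T)\cap\mathbb{T}=\varnothing$, where $\sigma(T)$ is the spectrum of $T$ and $\mathbb{T}=\{\lambda\in\mathbb{C}:|\lambda|=1\}$. Shadowing: an invertible operator $T$ on a Banach space $X$ has the shadowing property if for every $\varepsilon>0$ there is $\delta>0$ such that for every sequence $(x_j)_{j\in\mathbb{Z}}$ in $X$ with $\|T(x_j)-x_{j+1}\|\le\delta$ for all $j\in\mathbb{Z}$ there is $x\in X$ with $\|x_j-T^j(x)\|<\varepsilon$ for all $j\in\mathbb{Z}$. *)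

theory Defs
  imports "HOL-Complex_Analysis.Complex_Analysis" "HOL-Library.Function_Algebras"
begin

text \<open>
  The space of bounded holomorphic functions depends on the domain, so Banach spaces are given by a
  carrier: a linear subspace \<open>V\<close> of an ambient vector space with scalar multiplication \<open>scl\<close>, and
  a norm \<open>N\<close> of which only the values on \<open>V\<close> matter.
\<close>

locale complex_banach_space = vector_space scl
  for scl :: "complex \<Rightarrow> 'a::ab_group_add \<Rightarrow> 'a" +
  fixes V :: "'a set" and N :: "'a \<Rightarrow> real"
  assumes subspace_V: "subspace V"
    and N_eq_0: "x \<in> V \<Longrightarrow> N x = 0 \<Longrightarrow> x = 0"
    and N_scl: "x \<in> V \<Longrightarrow> N (scl c x) = norm c * N x"
    and N_triangle: "x \<in> V \<Longrightarrow> y \<in> V \<Longrightarrow> N (x + y) \<le> N x + N y"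
    and N_complete: "range u \<subseteq> V \<Longrightarrow> \<forall>e>0. \<exists>M. \<forall>m\<ge>M. \<forall>n\<ge>M. N (u m - u n) < e
      \<Longrightarrow> \<exists>x\<in>V. (\<lambda>n. N (u n - x)) \<longlonglongrightarrow> 0"

definition operator_on ::
    "'a::ab_group_add set \<Rightarrow> (complex \<Rightarrow> 'a \<Rightarrow> 'a) \<Rightarrow> ('a \<Rightarrow> real) \<Rightarrow> ('a \<Rightarrow> 'a) \<Rightarrow> bool" where
  "operator_on V scl N T \<longleftrightarrow>
     T ` V \<subseteq> V \<and>
     (\<forall>x\<in>V. \<forall>y\<in>V. T (x + y) = T x + T y) \<and>
     (\<forall>c. \<forall>x\<in>V. T (scl c x) = scl c (T x)) \<and>
     (\<forall>x\<in>V. \<forall>e>0. \<exists>d>0. \<forall>y\<in>V. N (y - x) < d \<longrightarrow> N (T y - T x) < e)"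

definition invertible_operator_on ::
    "'a::ab_group_add set \<Rightarrow> (complex \<Rightarrow> 'a \<Rightarrow> 'a) \<Rightarrow> ('a \<Rightarrow> real) \<Rightarrow> ('a \<Rightarrow> 'a) \<Rightarrow> bool" where
  "invertible_operator_on V scl N T \<longleftrightarrow>
     operator_on V scl N T \<and>
     (\<exists>S. operator_on V scl N S \<and> (\<forall>x\<in>V. S (T x) = x \<and> T (S x) = x))"

definition spectrum_on ::
    "'a::ab_group_add set \<Rightarrow> (complex \<Rightarrow> 'a \<Rightarrow> 'a) \<Rightarrow> ('a \<Rightarrow> real) \<Rightarrow> ('a \<Rightarrow> 'a) \<Rightarrow> complex set" where
  "spectrum_on V scl N T = {l. \<not> invertible_operator_on V scl N (\<lambda>x. T x - scl l x)}"

definition hyperbolic_on ::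
    "'a::ab_group_add set \<Rightarrow> (complex \<Rightarrow> 'a \<Rightarrow> 'a) \<Rightarrow> ('a \<Rightarrow> real) \<Rightarrow> ('a \<Rightarrow> 'a) \<Rightarrow> bool" where
  "hyperbolic_on V scl N T \<longleftrightarrow> spectrum_on V scl N T \<inter> {l. norm l = 1} = {}"

text \<open>Integer iterates of a bijection of \<open>V\<close>; the inverse is taken relative to \<open>V\<close>.\<close>

definition int_iterate :: "'a set \<Rightarrow> ('a \<Rightarrow> 'a) \<Rightarrow> int \<Rightarrow> 'a \<Rightarrow> 'a" where
  "int_iterate V T j = (if 0 \<le> j then T ^^ nat j else inv_into V T ^^ nat (- j))"

text \<open>Meaningful for \<open>T\<close> an invertible operator on \<open>V\<close>.\<close>

definition shadowing_on ::
    "'a::ab_group_add set \<Rightarrow> ('a \<Rightarrow> real) \<Rightarrow> ('a \<Rightarrow> 'a) \<Rightarrow> bool" where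
  "shadowing_on V N T \<longleftrightarrow>
     (\<forall>e>0. \<exists>d>0. \<forall>x :: int \<Rightarrow> 'a.
        (\<forall>j. x j \<in> V) \<and> (\<forall>j. N (T (x j) - x (j + 1)) \<le> d) \<longrightarrow>
        (\<exists>y\<in>V. \<forall>j. N (x j - int_iterate V T j y) < e))"

text \<open>Only the values on the closure of \<open>\<Omega>\<close> matter.\<close>

definition A_space :: "complex set \<Rightarrow> (complex \<Rightarrow> complex) set" where
  "A_space \<Omega> = {f. continuous_on (closure \<Omega>) f \<and> f holomorphic_on \<Omega>}"

text \<open>
  Functions on \<open>\<Omega>\<close> are represented by total functions vanishing outside \<open>\<Omega>\<close>, so that distinct
  elements differ somewhere on \<open>\<Omega>\<close> and the pointwise operations are those of the function type.
\<close>

definition restrict0 :: "complex set \<Rightarrow> (complex \<Rightarrow> complex) \<Rightarrow> complex \<Rightarrow> complex" where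
  "restrict0 \<Omega> f = (\<lambda>z. if z \<in> \<Omega> then f z else 0)"

definition Hinf :: "complex set \<Rightarrow> (complex \<Rightarrow> complex) set" where
  "Hinf \<Omega> = {f. f holomorphic_on \<Omega> \<and> bounded (f ` \<Omega>) \<and> (\<forall>z. z \<notin> \<Omega> \<longrightarrow> f z = 0)}"

definition Hinf_norm :: "complex set \<Rightarrow> (complex \<Rightarrow> complex) \<Rightarrow> real" where
  "Hinf_norm \<Omega> f = (SUP z\<in>\<Omega>. norm (f z))"

definition fun_scale :: "complex \<Rightarrow> (complex \<Rightarrow> complex) \<Rightarrow> complex \<Rightarrow> complex" where
  "fun_scale c f = (\<lambda>z. c * f z)"

definition mult_operator :: "(complex \<Rightarrow> complex) \<Rightarrow> (complex \<Rightarrow> complex) \<Rightarrow> complex \<Rightarrow> complex" where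
  "mult_operator \<omega> f = (\<lambda>z. f z * \<omega> z)"

lemma Hinf_norm_upper:
  assumes "f \<in> Hinf \<Omega>" "z \<in> \<Omega>"
  shows "norm (f z) \<le> Hinf_norm \<Omega> f"
proof -
  have "bdd_above ((\<lambda>z. norm (f z)) ` \<Omega>)"
    using assms(1) by (auto simp: Hinf_def bounded_iff bdd_above_def)
  thus ?thesis
    unfolding Hinf_norm_def using assms(2) by (intro cSUP_upper)
qed

lemma Hinf_norm_least:
  assumes "\<Omega> \<noteq> {}" "\<And>z. z \<in> \<Omega> \<Longrightarrow> norm (f z) \<le> B"
  shows "Hinf_norm \<Omega> f \<le> B"
  unfolding Hinf_norm_def using assms by (intro cSUP_least)

lemma Hinf_add: "f \<in> Hinf \<Omega> \<Longrightarrow> g \<in> Hinf \<Omega> \<Longrightarrow> f + g \<in> Hinf \<Omega>"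
  by (auto simp: Hinf_def plus_fun_def intro!: holomorphic_intros bounded_plus_comp)

lemma Hinf_scale:
  assumes "f \<in> Hinf \<Omega>"
  shows "fun_scale c f \<in> Hinf \<Omega>"
proof -
  have "bounded ((*) c ` (f ` \<Omega>))"
    by (rule bounded_linear_image[OF _ bounded_linear_mult_right]) (use assms in \<open>simp add: Hinf_def\<close>)
  with assms show ?thesis
    by (auto simp: Hinf_def fun_scale_def image_image intro!: holomorphic_intros)
qed

lemma Hinf_diff: "f \<in> Hinf \<Omega> \<Longrightarrow> g \<in> Hinf \<Omega> \<Longrightarrow> f - g \<in> Hinf \<Omega>"
  by (auto simp: Hinf_def fun_diff_def intro!: holomorphic_intros bounded_minus_comp)

lemma vector_space_fun_scale: "vector_space fun_scale"
  by unfold_locales (auto simp: fun_scale_def plus_fun_def algebra_simps)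

lemma Hinf_complete:
  assumes "\<Omega> \<noteq> {}" "open \<Omega>" and u: "range u \<subseteq> Hinf \<Omega>"
    and cau: "\<forall>e>0. \<exists>M. \<forall>m\<ge>M. \<forall>n\<ge>M. Hinf_norm \<Omega> (u m - u n) < e"
  shows "\<exists>f\<in>Hinf \<Omega>. (\<lambda>n. Hinf_norm \<Omega> (u n - f)) \<longlonglongrightarrow> 0"
proof -
  have un: "u n \<in> Hinf \<Omega>" for n using u by auto
  have "uniformly_Cauchy_on \<Omega> u"
    unfolding uniformly_Cauchy_on_def
  proof (intro allI impI)
    fix e :: real assume "e > 0"
    then obtain M where M: "\<And>m n. m \<ge> M \<Longrightarrow> n \<ge> M \<Longrightarrow> Hinf_norm \<Omega> (u m - u n) < e"
      using cau by blast
    have "dist (u m x) (u n x) < e" if "x \<in> \<Omega>" "m \<ge> M" "n \<ge> M" for x m n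
      using Hinf_norm_upper[OF Hinf_diff[OF un un] that(1), of m n] M[OF that(2,3)]
      by (simp add: dist_norm)
    thus "\<exists>M. \<forall>x\<in>\<Omega>. \<forall>m\<ge>M. \<forall>n\<ge>M. dist (u m x) (u n x) < e" by blast
  qed
  hence "uniformly_convergent_on \<Omega> u" by (rule Cauchy_uniformly_convergent)
  then obtain g where g: "uniform_limit \<Omega> u g sequentially"
    by (auto simp: uniformly_convergent_on_def)
  define f where "f = restrict0 \<Omega> g"
  have f: "uniform_limit \<Omega> u f sequentially"
    using g by (rule uniform_limit_cong'[THEN iffD1, rotated -1]) (auto simp: f_def restrict0_def)
  have "f holomorphic_on \<Omega>"
  proof (rule holomorphic_uniform_sequence[OF \<open>open \<Omega>\<close>])
    show "u n holomorphic_on \<Omega>" for n using un[of n] by (simp add: Hinf_def)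
    fix x assume "x \<in> \<Omega>"
    then obtain d where "d > 0" "cball x d \<subseteq> \<Omega>"
      using \<open>open \<Omega>\<close> open_contains_cball by blast
    thus "\<exists>d>0. cball x d \<subseteq> \<Omega> \<and> uniform_limit (cball x d) u f sequentially"
      using uniform_limit_on_subset[OF f] by blast
  qed
  moreover have "bounded (f ` \<Omega>)"
  proof -
    obtain n where n: "\<And>x. x \<in> \<Omega> \<Longrightarrow> dist (u n x) (f x) < 1"
      using f[unfolded uniform_limit_sequentially_iff, rule_format, of 1] by auto
    have "norm (f x) \<le> Hinf_norm \<Omega> (u n) + 1" if "x \<in> \<Omega>" for x
      using n[OF that] Hinf_norm_upper[OF un that, of n] norm_triangle_sub[of "f x" "u n x"]
      by (simp add: dist_norm norm_minus_commute)
    thus ?thesis by (auto simp: bounded_iff)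
  qed
  ultimately have fH: "f \<in> Hinf \<Omega>" by (auto simp: Hinf_def f_def restrict0_def)
  have "(\<lambda>n. Hinf_norm \<Omega> (u n - f)) \<longlonglongrightarrow> 0"
  proof (rule LIMSEQ_I)
    fix r :: real assume "r > 0"
    then obtain M where M: "\<And>n x. n \<ge> M \<Longrightarrow> x \<in> \<Omega> \<Longrightarrow> dist (u n x) (f x) < r / 2"
      using f[unfolded uniform_limit_sequentially_iff, rule_format, of "r / 2"] by auto
    have "norm (Hinf_norm \<Omega> (u n - f) - 0) < r" if "n \<ge> M" for n
    proof -
      have "Hinf_norm \<Omega> (u n - f) \<le> r / 2"
        using M[OF that] by (intro Hinf_norm_least[OF \<open>\<Omega> \<noteq> {}\<close>]) (auto simp: dist_norm less_imp_le)
      moreover obtain z where "z \<in> \<Omega>" using \<open>\<Omega> \<noteq> {}\<close> by blast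
      hence "0 \<le> Hinf_norm \<Omega> (u n - f)"
        using Hinf_norm_upper[OF Hinf_diff[OF un fH]] norm_ge_zero order_trans by blast
      ultimately show ?thesis using \<open>r > 0\<close> by simp
    qed
    thus "\<exists>no. \<forall>n\<ge>no. norm (Hinf_norm \<Omega> (u n - f) - 0) < r" by blast
  qed
  with fH show ?thesis by blast
qed

lemma Hinf_banach:
  assumes "\<Omega> \<noteq> {}" "open \<Omega>"
  shows "complex_banach_space fun_scale (Hinf \<Omega>) (Hinf_norm \<Omega>)"
proof -
  interpret vector_space fun_scale by (rule vector_space_fun_scale)
  obtain z0 where z0: "z0 \<in> \<Omega>" using assms by blast
  have le: "Hinf_norm \<Omega> (fun_scale c f) \<le> norm c * Hinf_norm \<Omega> f" if "f \<in> Hinf \<Omega>" for c f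
    using Hinf_norm_upper[OF that]
    by (intro Hinf_norm_least[OF assms(1)]) (auto simp: fun_scale_def norm_mult mult_left_mono)
  show ?thesis
  proof unfold_locales
    show "subspace (Hinf \<Omega>)"
    proof (rule subspaceI)
      show "0 \<in> Hinf \<Omega>" by (auto simp: Hinf_def zero_fun_def image_constant_conv)
    qed (auto intro: Hinf_add Hinf_scale)
  next
    fix f assume f: "f \<in> Hinf \<Omega>" "Hinf_norm \<Omega> f = 0"
    hence "f z = 0" for z using Hinf_norm_upper[OF f(1), of z] by (cases "z \<in> \<Omega>") (auto simp: Hinf_def)
    thus "f = 0" by auto
  next
    fix f c assume f: "f \<in> Hinf \<Omega>"
    show "Hinf_norm \<Omega> (fun_scale c f) = norm c * Hinf_norm \<Omega> f"
    proof (cases "c = 0")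
      case True
      have "0 \<le> Hinf_norm \<Omega> (fun_scale c f)"
        using Hinf_norm_upper[OF Hinf_scale[OF f] z0, of c] norm_ge_zero order_trans by blast
      with le[OF f, of c] True show ?thesis by simp
    next
      case False
      have "Hinf_norm \<Omega> (fun_scale (inverse c) (fun_scale c f))
          \<le> norm (inverse c) * Hinf_norm \<Omega> (fun_scale c f)"
        by (rule le[OF Hinf_scale[OF f]])
      with False have "norm c * Hinf_norm \<Omega> f \<le> Hinf_norm \<Omega> (fun_scale c f)"
        by (simp add: norm_divide field_simps)
      with le[OF f, of c] show ?thesis by simp
    qed
  next
    fix f g assume f: "f \<in> Hinf \<Omega>" and g: "g \<in> Hinf \<Omega>"
    show "Hinf_norm \<Omega> (f + g) \<le> Hinf_norm \<Omega> f + Hinf_norm \<Omega> g"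
      using Hinf_norm_upper[OF f] Hinf_norm_upper[OF g]
      by (intro Hinf_norm_least[OF assms(1)])
        (auto intro: order_trans[OF norm_triangle_ineq] add_mono)
  next
    fix u :: "nat \<Rightarrow> complex \<Rightarrow> complex" assume "range u \<subseteq> Hinf \<Omega>"
      "\<forall>e>0. \<exists>M. \<forall>m\<ge>M. \<forall>n\<ge>M. Hinf_norm \<Omega> (u m - u n) < e"
    thus "\<exists>f\<in>Hinf \<Omega>. (\<lambda>n. Hinf_norm \<Omega> (u n - f)) \<longlonglongrightarrow> 0"
      by (rule Hinf_complete[OF assms])
  qed
qed

end

theory Submission
  imports Defs
begin

text \<open>
  Everything is governed by the compact set \<open>K = closure (g ` \<Omega>)\<close>, where \<open>g\<close> is the bounded
  holomorphic multiplier; for \<open>w \<in> A(\<Omega>)\<close> it is \<open>w ` closure \<Omega>\<close> by compactness of \<open>closure \<Omega>\<close>.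

  The spectrum of multiplication by \<open>g\<close> is \<open>K\<close> (\<open>spectrum_mult_operator\<close>): an inverse of
  \<open>M\<^sub>g - l\<close> sends the constant \<open>1\<close> to \<open>1 / (g - l)\<close>, which is bounded precisely when \<open>l \<notin> K\<close>.
  Taking \<open>l = 0\<close> gives the invertibility of the operator, and hyperbolicity says that \<open>K\<close> misses
  the unit circle. So it remains to prove that shadowing says the same.

  If \<open>K\<close> misses the circle, then \<open>\<Omega>\<close> is the disjoint union of the open sets \<open>norm g < 1\<close> and
  \<open>norm g > 1\<close>, on which \<open>norm g \<le> r\<close> and \<open>1 / r \<le> norm g\<close>, respectively, for some \<open>r < 1\<close>. At
  each point \<open>z\<close> a pseudo-orbit is a scalar pseudo-orbit of multiplication by \<open>g z\<close>. In the
  contracting region the initial value of a shadowing orbit is \<open>lim g\<^sup>n x\<^bsub>-n\<^esub>\<close>, in the expanding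
  region it is \<open>lim g\<^bsup>-n\<^esup> x\<^bsub>n\<^esub>\<close>; both limits are uniform with geometric rate \<open>r\<^sup>n\<close>, so the two pieces
  form one bounded holomorphic function (\<open>shadowing_mult_operatorI\<close>).

  Conversely, suppose that \<open>a \<in> K\<close> has modulus \<open>1\<close>. The pseudo-orbit that starts at \<open>0\<close> and is
  driven from time \<open>0\<close> on by the small constants \<open>\<delta> a\<^sup>n\<close> is resonant: where \<open>g\<close> is near \<open>a\<close>, its
  value at time \<open>n\<close> is near \<open>n \<delta> a\<^sup>n\<close>, whereas an exact orbit that starts within \<open>1\<close> of \<open>0\<close>
  stays essentially bounded there (\<open>shadowing_mult_operatorD\<close>).
\<close>

section \<open>Multiplication operators on bounded holomorphic functions\<close>

lemma mult_operator_in_Hinf: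
  assumes g: "g holomorphic_on \<Omega>" "bounded (g ` \<Omega>)" and f: "f \<in> Hinf \<Omega>"
  shows "mult_operator g f \<in> Hinf \<Omega>"
proof -
  obtain B where B: "\<And>z. z \<in> \<Omega> \<Longrightarrow> norm (g z) \<le> B" using g(2) by (auto simp: bounded_iff)
  obtain C where C: "\<And>z. z \<in> \<Omega> \<Longrightarrow> norm (f z) \<le> C" using f by (auto simp: Hinf_def bounded_iff)
  have "norm (f z * g z) \<le> C * B" if "z \<in> \<Omega>" for z
    unfolding norm_mult using B[OF that] C[OF that]
    by (intro mult_mono order_trans[OF norm_ge_zero C[OF that]]) auto
  hence "bounded (mult_operator g f ` \<Omega>)" by (auto simp: bounded_iff mult_operator_def)
  with f g(1) show ?thesis by (auto simp: Hinf_def mult_operator_def intro!: holomorphic_intros)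
qed

lemma operator_on_mult_operator:
  assumes ne: "\<Omega> \<noteq> {}" and g: "g holomorphic_on \<Omega>" "bounded (g ` \<Omega>)"
  shows "operator_on (Hinf \<Omega>) fun_scale (Hinf_norm \<Omega>) (mult_operator g)"
proof -
  obtain B where "B > 0" and B: "\<And>z. z \<in> \<Omega> \<Longrightarrow> norm (g z) \<le> B"
    using g(2) by (auto simp: bounded_pos)
  have lip: "Hinf_norm \<Omega> (mult_operator g x - mult_operator g y) \<le> B * Hinf_norm \<Omega> (x - y)"
    if "x \<in> Hinf \<Omega>" "y \<in> Hinf \<Omega>" for x y
  proof (rule Hinf_norm_least[OF ne])
    fix z assume z: "z \<in> \<Omega>"
    have "(mult_operator g x - mult_operator g y) z = (x - y) z * g z"
      by (simp add: mult_operator_def algebra_simps)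
    moreover have "norm ((x - y) z) * norm (g z) \<le> Hinf_norm \<Omega> (x - y) * B"
      using Hinf_norm_upper[OF Hinf_diff[OF that] z] B[OF z]
      by (intro mult_mono) (auto intro: order_trans[OF norm_ge_zero])
    ultimately show "norm ((mult_operator g x - mult_operator g y) z) \<le> B * Hinf_norm \<Omega> (x - y)"
      by (simp only: norm_mult mult.commute)
  qed
  have "\<exists>d>0. \<forall>y\<in>Hinf \<Omega>. Hinf_norm \<Omega> (y - x) < d
          \<longrightarrow> Hinf_norm \<Omega> (mult_operator g y - mult_operator g x) < e"
    if "x \<in> Hinf \<Omega>" "e > 0" for x e
    using lip[OF _ that(1)] \<open>B > 0\<close> \<open>e > 0\<close>
    by (intro exI[of _ "e / B"]) (fastforce simp: field_simps intro: le_less_trans)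
  thus ?thesis
    using mult_operator_in_Hinf[OF g]
    by (auto simp: operator_on_def mult_operator_def fun_scale_def plus_fun_def algebra_simps)
qed

lemma not_in_closure_image_iff:
  fixes g :: "'a \<Rightarrow> 'b::real_normed_vector"
  shows "l \<notin> closure (g ` S) \<longleftrightarrow> (\<exists>c>0. \<forall>z\<in>S. c \<le> norm (g z - l))"
  by (force simp: closure_approachable dist_norm not_less)

lemma bounded_holomorphic_inverse:
  assumes g: "g holomorphic_on \<Omega>" and 0: "0 \<notin> closure (g ` \<Omega>)"
  shows "(\<lambda>z. inverse (g z)) holomorphic_on \<Omega>" "bounded ((\<lambda>z. inverse (g z)) ` \<Omega>)"
proof -
  obtain c where c: "c > 0" "\<And>z. z \<in> \<Omega> \<Longrightarrow> c \<le> norm (g z)"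
    using 0 by (auto simp: not_in_closure_image_iff)
  show "(\<lambda>z. inverse (g z)) holomorphic_on \<Omega>"
    using g c by (intro holomorphic_intros) fastforce+
  have "norm (inverse (g z)) \<le> inverse c" if "z \<in> \<Omega>" for z
    using c(1) c(2)[OF that] by (simp add: norm_inverse le_imp_inverse_le)
  thus "bounded ((\<lambda>z. inverse (g z)) ` \<Omega>)" by (auto simp: bounded_iff)
qed

lemma mult_operator_inverse:
  assumes "0 \<notin> closure (g ` \<Omega>)" "f \<in> Hinf \<Omega>"
  shows "mult_operator g (mult_operator (\<lambda>z. inverse (g z)) f) = f"
    and "mult_operator (\<lambda>z. inverse (g z)) (mult_operator g f) = f"
proof -
  have "g z \<noteq> 0" if "z \<in> \<Omega>" for z
    using assms(1) that closure_subset[of "g ` \<Omega>"] by (metis imageI subsetD)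
  hence "f z * (inverse (g z) * g z) = f z" for z
    using assms(2) by (cases "z \<in> \<Omega>") (auto simp: Hinf_def)
  thus "mult_operator g (mult_operator (\<lambda>z. inverse (g z)) f) = f"
    and "mult_operator (\<lambda>z. inverse (g z)) (mult_operator g f) = f"
    by (auto simp: mult_operator_def fun_eq_iff ac_simps)
qed

lemma restrict0_const_in_Hinf: "restrict0 \<Omega> (\<lambda>_. c) \<in> Hinf \<Omega>"
proof -
  have "restrict0 \<Omega> (\<lambda>_. c) holomorphic_on \<Omega>"
    by (rule holomorphic_transform[of "\<lambda>_. c"]) (auto simp: restrict0_def)
  moreover have "bounded (restrict0 \<Omega> (\<lambda>_. c) ` \<Omega>)"
    by (auto simp: bounded_iff restrict0_def)
  ultimately show ?thesis by (auto simp: Hinf_def restrict0_def)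
qed

text \<open>
  An inverse must map the constant function \<open>1\<close> to \<open>1 / g\<close>; the boundedness of that single image
  already keeps \<open>g\<close> away from \<open>0\<close>.
\<close>
lemma invertible_mult_operator_iff:
  assumes ne: "\<Omega> \<noteq> {}" and g: "g holomorphic_on \<Omega>" "bounded (g ` \<Omega>)"
  shows "invertible_operator_on (Hinf \<Omega>) fun_scale (Hinf_norm \<Omega>) (mult_operator g)
    \<longleftrightarrow> 0 \<notin> closure (g ` \<Omega>)"
proof
  assume 0: "0 \<notin> closure (g ` \<Omega>)"
  show "invertible_operator_on (Hinf \<Omega>) fun_scale (Hinf_norm \<Omega>) (mult_operator g)"
    unfolding invertible_operator_on_def
    using operator_on_mult_operator[OF ne g]
      operator_on_mult_operator[OF ne bounded_holomorphic_inverse[OF g(1) 0]]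
      mult_operator_inverse[OF 0] by blast
next
  assume "invertible_operator_on (Hinf \<Omega>) fun_scale (Hinf_norm \<Omega>) (mult_operator g)"
  then obtain S where S: "operator_on (Hinf \<Omega>) fun_scale (Hinf_norm \<Omega>) S"
      "\<And>x. x \<in> Hinf \<Omega> \<Longrightarrow> mult_operator g (S x) = x"
    unfolding invertible_operator_on_def by blast
  define f where "f = S (restrict0 \<Omega> (\<lambda>_. 1))"
  have f: "f \<in> Hinf \<Omega>"
    using S(1) restrict0_const_in_Hinf unfolding f_def operator_on_def by blast
  then obtain B where "B > 0" and B: "\<And>z. z \<in> \<Omega> \<Longrightarrow> norm (f z) \<le> B"
    by (auto simp: Hinf_def bounded_pos)
  have "1 / B \<le> norm (g z)" if z: "z \<in> \<Omega>" for z
  proof -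
    have "f z * g z = 1"
      using fun_cong[OF S(2)[OF restrict0_const_in_Hinf[of \<Omega> 1]], of z] z
      by (simp add: f_def mult_operator_def restrict0_def)
    hence "1 = norm (f z) * norm (g z)" by (metis norm_mult norm_one)
    also have "\<dots> \<le> B * norm (g z)" using B[OF z] by (intro mult_right_mono) auto
    finally show ?thesis using \<open>B > 0\<close> by (simp add: field_simps)
  qed
  with \<open>B > 0\<close> show "0 \<notin> closure (g ` \<Omega>)"
    unfolding not_in_closure_image_iff by (intro exI[of _ "1 / B"]) auto
qed

lemma spectrum_mult_operator:
  assumes ne: "\<Omega> \<noteq> {}" and g: "g holomorphic_on \<Omega>" "bounded (g ` \<Omega>)"
  shows "spectrum_on (Hinf \<Omega>) fun_scale (Hinf_norm \<Omega>) (mult_operator g) = closure (g ` \<Omega>)"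
proof -
  have "l \<in> spectrum_on (Hinf \<Omega>) fun_scale (Hinf_norm \<Omega>) (mult_operator g)
      \<longleftrightarrow> l \<in> closure (g ` \<Omega>)" for l
  proof -
    \<comment> \<open>Shifting the operator by a scalar shifts the symbol.\<close>
    have "(\<lambda>x. mult_operator g x - fun_scale l x) = mult_operator (\<lambda>z. g z - l)"
      by (auto simp: mult_operator_def fun_scale_def fun_eq_iff algebra_simps)
    moreover have "(\<lambda>z. g z - l) holomorphic_on \<Omega>" using g(1) by (intro holomorphic_intros)
    moreover have "bounded ((\<lambda>z. g z - l) ` \<Omega>)"
      using bounded_minus_comp[OF g(2), of "\<lambda>_. l"] by (auto simp: image_constant_conv)
    ultimately have "l \<in> spectrum_on (Hinf \<Omega>) fun_scale (Hinf_norm \<Omega>) (mult_operator g)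
        \<longleftrightarrow> 0 \<in> closure ((\<lambda>z. g z - l) ` \<Omega>)"
      by (simp add: spectrum_on_def invertible_mult_operator_iff[OF ne])
    also have "\<dots> \<longleftrightarrow> l \<in> closure (g ` \<Omega>)"
      using not_in_closure_image_iff[of l g \<Omega>] not_in_closure_image_iff[of 0 "\<lambda>z. g z - l" \<Omega>]
      by auto
    finally show ?thesis .
  qed
  thus ?thesis by blast
qed

section \<open>Iterates\<close>

lemma funpow_mult_operator: "(mult_operator g ^^ n) f = mult_operator (\<lambda>z. g z ^ n) f"
  by (induction n) (auto simp: mult_operator_def fun_eq_iff ac_simps)

text \<open>
  The iteration of \<open>inv_into\<close> stays in the subspace, where it is multiplication by \<open>1 / g\<close>. Outside
  \<open>\<Omega>\<close> the symbol may vanish, but there \<open>f\<close> vanishes too.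
\<close>
lemma int_iterate_mult_operator:
  assumes g: "g holomorphic_on \<Omega>" "bounded (g ` \<Omega>)" and 0: "0 \<notin> closure (g ` \<Omega>)"
    and f: "f \<in> Hinf \<Omega>"
  shows "int_iterate (Hinf \<Omega>) (mult_operator g) j f = mult_operator (\<lambda>z. g z powi j) f"
proof -
  let ?S = "mult_operator (\<lambda>z. inverse (g z))"
  have S_in: "?S h \<in> Hinf \<Omega>" if "h \<in> Hinf \<Omega>" for h
    by (intro mult_operator_in_Hinf bounded_holomorphic_inverse g 0 that)
  have inj: "inj_on (mult_operator g) (Hinf \<Omega>)"
    by (rule inj_on_inverseI[of _ ?S]) (rule mult_operator_inverse[OF 0])
  have inv: "inv_into (Hinf \<Omega>) (mult_operator g) h = ?S h" if "h \<in> Hinf \<Omega>" for h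
    using inv_into_f_f[OF inj S_in[OF that]] by (simp only: mult_operator_inverse(1)[OF 0 that])
  have "(inv_into (Hinf \<Omega>) (mult_operator g) ^^ n) f = (?S ^^ n) f \<and> (?S ^^ n) f \<in> Hinf \<Omega>" for n
    by (induction n) (auto simp: f inv S_in)
  thus ?thesis
    by (auto simp: int_iterate_def funpow_mult_operator power_int_def power_inverse)
qed

section \<open>Scalar shadowing\<close>

text \<open>
  A contraction by \<open>r\<close> turns the drift \<open>D\<close> after \<open>n\<close> steps into at most \<open>r D + d\<close> after \<open>n + 1\<close>
  steps, and \<open>d / (1 - r)\<close> is the fixed point of \<open>D \<mapsto> r D + d\<close>.
\<close>
lemma scalar_pseudo_orbit_drift:
  fixes a :: complex and x :: "int \<Rightarrow> complex"
  assumes r: "r < 1" "norm a \<le> r" and e: "\<And>j. norm (a * x j - x (j + 1)) \<le> d"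
  shows "norm (x (j + int n) - a ^ n * x j) \<le> d / (1 - r)"
proof (induction n)
  case 0
  have "0 \<le> d" using e[of 0] norm_ge_zero order_trans by blast
  with r show ?case by simp
next
  case (Suc n)
  let ?k = "j + int n"
  have "x (j + int (Suc n)) - a ^ Suc n * x j
      = a * (x ?k - a ^ n * x j) - (a * x ?k - x (?k + 1))"
    by (simp add: algebra_simps)
  hence "norm (x (j + int (Suc n)) - a ^ Suc n * x j)
      \<le> norm a * norm (x ?k - a ^ n * x j) + norm (a * x ?k - x (?k + 1))"
    by (metis norm_mult norm_triangle_ineq4)
  also have "\<dots> \<le> r * (d / (1 - r)) + d"
    using r(2) Suc e[of ?k] by (intro add_mono mult_mono) (auto intro: order_trans[OF norm_ge_zero])
  also have "\<dots> = d / (1 - r)" using r(1) by (simp add: field_simps)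
  finally show ?case .
qed

text \<open>
  Starting the exact orbit at \<open>x (- n)\<close> at time \<open>- n\<close>, it has drifted by at most \<open>d / (1 - r)\<close> at every
  later time. The values \<open>a ^ n * x (- n)\<close> of these orbits at time \<open>0\<close> form a Cauchy sequence, and the
  drift bound passes to the orbit of their limit. The convergence rate is independent of \<open>a\<close>, \<open>x\<close>:
  this will make the convergence uniform in the point of evaluation.
\<close>
lemma scalar_shadow_contracting:
  fixes a :: complex and x :: "int \<Rightarrow> complex"
  assumes a: "a \<noteq> 0" and r: "r < 1" "norm a \<le> r" and e: "\<And>j. norm (a * x j - x (j + 1)) \<le> d"
  shows "\<exists>y. (\<forall>n. norm (a ^ n * x (- int n) - y) \<le> r ^ n * (d / (1 - r)))
           \<and> (\<forall>j. norm (x j - a powi j * y) \<le> d / (1 - r))"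
proof -
  let ?K = "d / (1 - r)"
  define p where "p n = a ^ n * x (- int n)" for n
  have r0: "0 \<le> r" using r(2) norm_ge_zero order_trans by blast
  have K0: "0 \<le> ?K" using scalar_pseudo_orbit_drift[of r a x, OF r e, of 0 0] norm_ge_zero order_trans by blast
  have step: "norm (p n - p (n + m)) \<le> r ^ n * ?K" for n m
  proof -
    have "p n - p (n + m) = a ^ n * (x (- int n) - a ^ m * x (- int (n + m)))"
      by (simp add: p_def algebra_simps power_add)
    also have "norm \<dots> \<le> r ^ n * ?K"
      unfolding norm_mult norm_power
      using scalar_pseudo_orbit_drift[of r a x, OF r e, of "- int (n + m)" m] r r0 K0
      by (intro mult_mono power_mono) auto
    finally show ?thesis .
  qed
  have "(\<lambda>n. r ^ n * ?K) \<longlonglongrightarrow> 0"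
    using r r0 by (auto intro!: tendsto_mult_left_zero LIMSEQ_power_zero)
  have "Cauchy p"
  proof (rule CauchyI')
    fix \<epsilon> :: real assume "\<epsilon> > 0"
    then obtain M where M: "r ^ n * ?K < \<epsilon>" if "n \<ge> M" for n
      using order_tendstoD(2)[OF \<open>(\<lambda>n. r ^ n * ?K) \<longlonglongrightarrow> 0\<close>]
      unfolding eventually_sequentially by blast
    have "norm (p m - p n) < \<epsilon>" if "m \<ge> M" "n > m" for m n
      using step[of m "n - m"] M[OF that(1)] that(2) by simp
    thus "\<exists>M. \<forall>m\<ge>M. \<forall>n>m. dist (p m) (p n) < \<epsilon>" by (auto simp: dist_norm)
  qed
  then obtain y where y: "p \<longlonglongrightarrow> y" by (auto simp: Cauchy_convergent_iff convergent_def)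
  have "norm (p n - y) \<le> r ^ n * ?K" for n
  proof (rule tendsto_upperbound)
    show "(\<lambda>m. norm (p n - p (n + m))) \<longlonglongrightarrow> norm (p n - y)"
      using LIMSEQ_ignore_initial_segment[OF y, of n]
      by (intro tendsto_intros) (simp add: add.commute)
  qed (use step in auto)
  moreover have "norm (x j - a powi j * y) \<le> ?K" for j
  proof (rule tendsto_upperbound)
    show "(\<lambda>n. norm (x j - a powi j * p n)) \<longlonglongrightarrow> norm (x j - a powi j * y)"
      using y by (intro tendsto_intros)
    have "norm (x j - a powi j * p n) \<le> ?K" if "n \<ge> nat (- j)" for n
    proof -
      have eq: "j + int n = int (nat (j + int n))" using that by simp
      have "a powi j * p n = a powi (j + int n) * x (- int n)"
        using a by (simp add: p_def power_int_add)
      also have "\<dots> = a ^ nat (j + int n) * x (- int n)"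
        by (subst eq) (simp only: power_int_of_nat)
      finally show ?thesis
        using scalar_pseudo_orbit_drift[of r a x, OF r e, of "- int n" "nat (j + int n)"] eq by simp
    qed
    thus "\<forall>\<^sub>F n in sequentially. norm (x j - a powi j * p n) \<le> ?K"
      by (auto simp: eventually_sequentially)
  qed simp
  ultimately show ?thesis unfolding p_def by blast
qed

text \<open>
  Reversing time turns the expansion by \<open>a\<close> into the contraction by \<open>1 / a\<close>, with errors that are
  at most as large.
\<close>
lemma scalar_shadow_expanding:
  fixes a :: complex and x :: "int \<Rightarrow> complex"
  assumes r: "r < 1" "1 \<le> r * norm a" and e: "\<And>j. norm (a * x j - x (j + 1)) \<le> d"
  shows "\<exists>y. (\<forall>n. norm (inverse a ^ n * x (int n) - y) \<le> r ^ n * (d / (1 - r)))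
           \<and> (\<forall>j. norm (x j - a powi j * y) \<le> d / (1 - r))"
proof -
  have a: "a \<noteq> 0" using r(2) by auto
  have ia: "norm (inverse a) \<le> r" unfolding norm_inverse using r(2) a by (simp add: field_simps)
  have "norm (inverse a * x (- j) - x (- (j + 1))) \<le> d" for j
  proof -
    define k where "k = - (j + 1)"
    have "inverse a * x (k + 1) - x k = - (inverse a * (a * x k - x (k + 1)))"
      using a by (simp add: right_diff_distrib flip: mult.assoc)
    hence "norm (inverse a * x (k + 1) - x k) = norm (inverse a) * norm (a * x k - x (k + 1))"
      by (simp only: norm_minus_cancel norm_mult)
    also have "\<dots> \<le> 1 * d" using ia r(1) e[of k] by (intro mult_mono) auto
    finally show ?thesis by (simp add: k_def)
  qed
  from scalar_shadow_contracting[of "inverse a" r "\<lambda>j. x (- j)", OF _ r(1) ia this] a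
  obtain y where y: "\<And>n. norm (inverse a ^ n * x (int n) - y) \<le> r ^ n * (d / (1 - r))"
      "\<And>j. norm (x (- j) - inverse a powi j * y) \<le> d / (1 - r)" by auto
  have "norm (x j - a powi j * y) \<le> d / (1 - r)" for j
    using y(2)[of "- j"] by (simp add: power_int_minus power_int_inverse)
  with y(1) show ?thesis by blast
qed

section \<open>Shadowing for multiplication operators\<close>

lemma unit_circle_gap:
  fixes g :: "'a \<Rightarrow> complex"
  assumes "bounded (g ` S)" "closure (g ` S) \<inter> sphere 0 1 = {}"
  obtains r where "0 < r" "r < 1" "\<And>z. z \<in> S \<Longrightarrow> norm (g z) \<le> r \<or> 1 \<le> r * norm (g z)"
proof -
  (* The set of moduli is closed and omits 1, hence omits an interval (1 - \<epsilon>, 1 + \<epsilon>); then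
     r = 1 / (1 + \<epsilon>) works on both sides, as 1 - \<epsilon> \<le> 1 / (1 + \<epsilon>). *)
  have "compact (norm ` closure (g ` S))"
    using assms(1) by (intro compact_continuous_image continuous_intros) (simp add: compact_closure)
  hence "open (- (norm ` closure (g ` S)))" using compact_imp_closed by blast
  moreover have "1 \<in> - (norm ` closure (g ` S))" using assms(2) by force
  ultimately obtain \<epsilon> where "\<epsilon> > 0" and \<epsilon>: "ball 1 \<epsilon> \<subseteq> - (norm ` closure (g ` S))"
    using openE by blast
  show ?thesis
  proof (rule that[of "1 / (1 + \<epsilon>)"])
    fix z assume "z \<in> S"
    hence "norm (g z) \<in> norm ` closure (g ` S)" using closure_subset by blast
    hence "norm (g z) \<notin> ball 1 \<epsilon>" using \<epsilon> by blast
    hence "norm (g z) \<le> 1 - \<epsilon> \<or> 1 + \<epsilon> \<le> norm (g z)" by (auto simp: dist_real_def)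
    moreover have "1 - \<epsilon> \<le> 1 / (1 + \<epsilon>)" using \<open>\<epsilon> > 0\<close> by (simp add: field_simps)
    moreover have "1 \<le> 1 / (1 + \<epsilon>) * norm (g z)" if "1 + \<epsilon> \<le> norm (g z)"
      using that \<open>\<epsilon> > 0\<close> by (simp add: field_simps)
    ultimately show "norm (g z) \<le> 1 / (1 + \<epsilon>) \<or> 1 \<le> 1 / (1 + \<epsilon>) * norm (g z)"
      by linarith
  qed (use \<open>\<epsilon> > 0\<close> in auto)
qed

text \<open>
  The shadowing point is obtained pointwise from the scalar lemmas. It is holomorphic as the uniform
  limit on \<open>\<Omega>\<close> of the functions \<open>p n\<close>, whose two defining branches live on disjoint open sets.
\<close>
lemma shadowing_mult_operatorI:
  assumes ne: "\<Omega> \<noteq> {}" and op: "open \<Omega>"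
    and g: "g holomorphic_on \<Omega>" "bounded (g ` \<Omega>)" and 0: "0 \<notin> closure (g ` \<Omega>)"
    and circ: "closure (g ` \<Omega>) \<inter> sphere 0 1 = {}"
  shows "shadowing_on (Hinf \<Omega>) (Hinf_norm \<Omega>) (mult_operator g)"
proof -
  obtain r where r: "0 < r" "r < 1"
    and gap: "\<And>z. z \<in> \<Omega> \<Longrightarrow> norm (g z) \<le> r \<or> 1 \<le> r * norm (g z)"
    using unit_circle_gap[OF g(2) circ] by blast
  have g0: "g z \<noteq> 0" if "z \<in> \<Omega>" for z
    using 0 that closure_subset[of "g ` \<Omega>"] by (metis imageI subsetD)
  have "\<exists>y\<in>Hinf \<Omega>. \<forall>j. Hinf_norm \<Omega> (x j - int_iterate (Hinf \<Omega>) (mult_operator g) j y) \<le> d / (1 - r)"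
    if x: "\<And>j. x j \<in> Hinf \<Omega>" and e: "\<And>j. Hinf_norm \<Omega> (mult_operator g (x j) - x (j + 1)) \<le> d"
    for d and x :: "int \<Rightarrow> complex \<Rightarrow> complex"
  proof -
    \<comment> \<open>\<open>p n\<close> is the value at time \<open>0\<close> of the orbit through the pseudo-orbit at time \<open>- n\<close> or \<open>n\<close>.\<close>
    define p where "p n z = (if norm (g z) < 1 then g z ^ n * x (- int n) z
                             else inverse (g z) ^ n * x (int n) z)" for n z
    have e': "norm (g z * x j z - x (j + 1) z) \<le> d" if "z \<in> \<Omega>" for z j
      using Hinf_norm_upper[OF Hinf_diff[OF mult_operator_in_Hinf[OF g x[of j]] x[of "j + 1"]] that]
        e[of j] by (simp add: mult_operator_def mult.commute)
    have "\<exists>y. (\<forall>n. norm (p n z - y) \<le> r ^ n * (d / (1 - r)))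
           \<and> (\<forall>j. norm (x j z - g z powi j * y) \<le> d / (1 - r))" if z: "z \<in> \<Omega>" for z
    proof (cases "norm (g z) \<le> r")
      case True
      with r scalar_shadow_contracting[of "g z" r "\<lambda>j. x j z", OF g0[OF z] r(2) True e'[OF z]]
      show ?thesis by (simp add: p_def)
    next
      case False
      hence g1: "1 \<le> r * norm (g z)" using gap[OF z] by blast
      hence "\<not> norm (g z) < 1" using r mult_strict_mono[of r 1 "norm (g z)" 1] by auto
      with scalar_shadow_expanding[of r "g z" "\<lambda>j. x j z", OF r(2) g1 e'[OF z]] show ?thesis by (simp add: p_def)
    qed
    then obtain y' where y':
        "\<And>z n. z \<in> \<Omega> \<Longrightarrow> norm (p n z - y' z) \<le> r ^ n * (d / (1 - r))"
        "\<And>z j. z \<in> \<Omega> \<Longrightarrow> norm (x j z - g z powi j * y' z) \<le> d / (1 - r)"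
      by metis
    define y where "y = restrict0 \<Omega> y'"
    have y: "norm (p n z - y z) \<le> r ^ n * (d / (1 - r))"
        "norm (x j z - g z powi j * y z) \<le> d / (1 - r)" if "z \<in> \<Omega>" for z n j
      using y'[OF that] that by (auto simp: y_def restrict0_def)
    have x_hol: "x j holomorphic_on \<Omega>" for j using x[of j] by (simp add: Hinf_def)
    have p_hol: "p n holomorphic_on \<Omega>" for n
    proof -
      let ?A = "\<Omega> \<inter> g -` ball 0 1" and ?B = "\<Omega> \<inter> g -` (- cball 0 1)"
      have gc: "continuous_on \<Omega> g" using g(1) by (rule holomorphic_on_imp_continuous_on)
      have "p n holomorphic_on ?A"
        by (rule holomorphic_transform[of "\<lambda>z. g z ^ n * x (- int n) z"])
          (auto simp: p_def intro!: holomorphic_intros holomorphic_on_subset[OF g(1)]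
            holomorphic_on_subset[OF x_hol])
      moreover have "p n holomorphic_on ?B"
        by (rule holomorphic_transform[of "\<lambda>z. inverse (g z) ^ n * x (int n) z"])
          (auto simp: p_def g0 intro!: holomorphic_intros holomorphic_on_subset[OF g(1)]
            holomorphic_on_subset[OF x_hol])
      moreover have "open ?A" "open ?B"
        by (rule continuous_open_preimage[OF gc op]; simp add: open_Compl)+
      ultimately have "p n holomorphic_on ?A \<union> ?B" by (intro holomorphic_on_Un) auto
      moreover have "\<Omega> = ?A \<union> ?B" using circ closure_subset[of "g ` \<Omega>"] by force
      ultimately show ?thesis by simp
    qed
    have unif: "uniform_limit \<Omega> p y sequentially"
    proof (rule uniform_limitI)
      fix \<epsilon> :: real assume "\<epsilon> > 0"
      have "\<forall>\<^sub>F n in sequentially. r ^ n * (d / (1 - r)) < \<epsilon>"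
        by (rule order_tendstoD(2)[OF _ \<open>\<epsilon> > 0\<close>])
          (use r in \<open>auto intro!: tendsto_mult_left_zero LIMSEQ_power_zero\<close>)
      thus "\<forall>\<^sub>F n in sequentially. \<forall>z\<in>\<Omega>. dist (p n z) (y z) < \<epsilon>"
        by eventually_elim (auto simp: dist_norm intro: le_less_trans[OF y(1)])
    qed
    have "y holomorphic_on \<Omega>"
    proof (rule holomorphic_uniform_sequence[OF op p_hol])
      fix z assume "z \<in> \<Omega>"
      then obtain \<rho> where "\<rho> > 0" "cball z \<rho> \<subseteq> \<Omega>" using op open_contains_cball by blast
      thus "\<exists>\<rho>>0. cball z \<rho> \<subseteq> \<Omega> \<and> uniform_limit (cball z \<rho>) p y sequentially"
        using uniform_limit_on_subset[OF unif] by blast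
    qed
    moreover have "bounded (y ` \<Omega>)"
    proof -
      have "norm (y z) \<le> Hinf_norm \<Omega> (x 0) + d / (1 - r)" if "z \<in> \<Omega>" for z
        using y(2)[OF that, of 0] Hinf_norm_upper[OF x that, of 0]
          norm_triangle_sub[of "y z" "x 0 z"] by (simp add: norm_minus_commute)
      thus ?thesis by (auto simp: bounded_iff)
    qed
    ultimately have yH: "y \<in> Hinf \<Omega>" by (auto simp: Hinf_def y_def restrict0_def)
    have "Hinf_norm \<Omega> (x j - int_iterate (Hinf \<Omega>) (mult_operator g) j y) \<le> d / (1 - r)" for j
      using y(2) by (intro Hinf_norm_least[OF ne])
        (simp add: int_iterate_mult_operator[OF g 0 yH] mult_operator_def mult.commute)
    with yH show ?thesis by blast
  qed
  note shadow = this
  show ?thesis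
    unfolding shadowing_on_def
  proof (intro allI impI)
    fix \<epsilon> :: real assume "\<epsilon> > 0"
    have half: "\<epsilon> / 2 * (1 - r) / (1 - r) < \<epsilon>" 
      using r \<open>\<epsilon> > 0\<close> by (subst nonzero_mult_div_cancel_right) auto
    show "\<exists>d>0. \<forall>x. (\<forall>j. x j \<in> Hinf \<Omega>) \<and> (\<forall>j. Hinf_norm \<Omega> (mult_operator g (x j) - x (j + 1)) \<le> d)
        \<longrightarrow> (\<exists>y\<in>Hinf \<Omega>. \<forall>j. Hinf_norm \<Omega> (x j - int_iterate (Hinf \<Omega>) (mult_operator g) j y) < \<epsilon>)"
    proof (intro exI[of _ "\<epsilon> / 2 * (1 - r)"] conjI allI impI)
      show "0 < \<epsilon> / 2 * (1 - r)" using r \<open>\<epsilon> > 0\<close> by simp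
    next
      fix x :: "int \<Rightarrow> complex \<Rightarrow> complex"
      assume "(\<forall>j. x j \<in> Hinf \<Omega>)
        \<and> (\<forall>j. Hinf_norm \<Omega> (mult_operator g (x j) - x (j + 1)) \<le> \<epsilon> / 2 * (1 - r))"
      thus "\<exists>y\<in>Hinf \<Omega>. \<forall>j. Hinf_norm \<Omega> (x j - int_iterate (Hinf \<Omega>) (mult_operator g) j y) < \<epsilon>"
        using shadow[of x "\<epsilon> / 2 * (1 - r)"] half le_less_trans by blast
    qed
  qed
qed

text \<open>
  Resonance: the driven pseudo-orbit has the closed form \<open>\<delta> * (\<Sum>k<n. g ^ k * a ^ (n - k))\<close>. A
  point that shadows it within \<open>1\<close> is itself bounded by \<open>1\<close> (time \<open>0\<close>), so at time \<open>n\<close> this sum is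
  bounded by \<open>1 + norm g ^ n\<close> on \<open>\<Omega>\<close>. The estimate involves only the values of \<open>g\<close>, so it extends by
  continuity to \<open>closure (g ` \<Omega>)\<close>; at the value \<open>a\<close> it reads \<open>\<delta> * n \<le> 2\<close>, which fails for large \<open>n\<close>.
\<close>
lemma shadowing_mult_operatorD:
  assumes ne: "\<Omega> \<noteq> {}"
    and g: "g holomorphic_on \<Omega>" "bounded (g ` \<Omega>)" and 0: "0 \<notin> closure (g ` \<Omega>)"
    and sh: "shadowing_on (Hinf \<Omega>) (Hinf_norm \<Omega>) (mult_operator g)"
    and a: "norm a = 1"
  shows "a \<notin> closure (g ` \<Omega>)"
proof
  assume cl: "a \<in> closure (g ` \<Omega>)"
  obtain \<delta> where "\<delta> > 0" and \<delta>: "\<And>x. (\<And>j. x j \<in> Hinf \<Omega>) \<Longrightarrow>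
      (\<And>j. Hinf_norm \<Omega> (mult_operator g (x j) - x (j + 1)) \<le> \<delta>) \<Longrightarrow>
      \<exists>y\<in>Hinf \<Omega>. \<forall>j. Hinf_norm \<Omega> (x j - int_iterate (Hinf \<Omega>) (mult_operator g) j y) < 1"
    using sh[unfolded shadowing_on_def, rule_format, of 1] by auto
  define c where "c n = restrict0 \<Omega> (\<lambda>_. complex_of_real \<delta> * a ^ n)" for n
  define X where "X = rec_nat 0 (\<lambda>n f. mult_operator g f + c (Suc n))"
  have X: "X 0 = 0" "X (Suc n) = mult_operator g (X n) + c (Suc n)" for n by (auto simp: X_def)
  have XH: "X n \<in> Hinf \<Omega>" for n
  proof (induction n)
    case 0
    show ?case using restrict0_const_in_Hinf[of \<Omega> 0] by (simp add: X restrict0_def zero_fun_def)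
  next
    case (Suc n)
    thus ?case unfolding X c_def
      by (intro Hinf_add mult_operator_in_Hinf[OF g] restrict0_const_in_Hinf)
  qed
  have X_eq: "X n z = \<delta> * (\<Sum>k<n. g z ^ k * a ^ (n - k))" if "z \<in> \<Omega>" for n z
  proof (induction n)
    case (Suc n)
    have "X (Suc n) z = g z * X n z + \<delta> * a ^ Suc n"
      using that by (simp add: X c_def restrict0_def mult_operator_def mult.commute)
    also have "\<dots> = \<delta> * (a ^ Suc n + (\<Sum>k<n. g z ^ Suc k * a ^ (Suc n - Suc k)))"
      by (simp add: Suc sum_distrib_left distrib_left ac_simps)
    also have "\<dots> = \<delta> * (\<Sum>k<Suc n. g z ^ k * a ^ (Suc n - k))"
      unfolding sum.lessThan_Suc_shift by simp
    finally show ?case .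
  qed (simp add: X)
  \<comment> \<open>\<open>nat\<close> truncates, so the pseudo-orbit is constantly \<open>0\<close> at negative times.\<close>
  have "Hinf_norm \<Omega> (mult_operator g (X (nat j)) - X (nat (j + 1))) \<le> \<delta>" for j
  proof (rule Hinf_norm_least[OF ne])
    fix z assume z: "z \<in> \<Omega>"
    show "norm ((mult_operator g (X (nat j)) - X (nat (j + 1))) z) \<le> \<delta>"
    proof (cases "0 \<le> j")
      case True
      hence "nat (j + 1) = Suc (nat j)" by simp
      thus ?thesis using z a \<open>\<delta> > 0\<close>
        by (simp add: X c_def restrict0_def norm_mult norm_power)
    next
      case False
      thus ?thesis using \<open>\<delta> > 0\<close> by (simp add: X mult_operator_def)
    qed
  qed
  from \<delta>[of "\<lambda>j. X (nat j)", OF XH this] obtain y where yH: "y \<in> Hinf \<Omega>"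
    and y: "\<And>j. Hinf_norm \<Omega> (X (nat j) - int_iterate (Hinf \<Omega>) (mult_operator g) j y) < 1"
    by blast
  have y': "norm (X n z - g z ^ n * y z) < 1" if "z \<in> \<Omega>" for z n
  proof -
    have it: "int_iterate (Hinf \<Omega>) (mult_operator g) (int n) y = mult_operator (\<lambda>z. g z ^ n) y"
      by (simp add: int_iterate_mult_operator[OF g 0 yH])
    have "(mult_operator g ^^ n) y \<in> Hinf \<Omega>"
      by (induction n) (auto simp: yH mult_operator_in_Hinf[OF g])
    hence "X n - mult_operator (\<lambda>z. g z ^ n) y \<in> Hinf \<Omega>"
      by (intro Hinf_diff XH) (simp add: funpow_mult_operator)
    from Hinf_norm_upper[OF this that] y[of "int n", unfolded it nat_int]
    show ?thesis by (simp add: mult_operator_def mult.commute)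
  qed
  have "\<delta> * real n \<le> 2" for n
  proof -
    let ?h = "\<lambda>b. norm (\<delta> * (\<Sum>k<n. b ^ k * a ^ (n - k))) - norm b ^ n"
    have "?h b \<le> 1" if b: "b \<in> g ` \<Omega>" for b
    proof -
      obtain z where z: "z \<in> \<Omega>" "b = g z" using b by blast
      have "norm (X n z) \<le> norm (X n z - g z ^ n * y z) + norm (g z) ^ n * norm (y z)"
        using norm_triangle_ineq[of "X n z - g z ^ n * y z" "g z ^ n * y z"]
        by (simp add: norm_mult norm_power)
      moreover have "norm (g z) ^ n * norm (y z) \<le> norm (g z) ^ n"
        using y'[OF z(1), of 0] by (intro mult_left_le) (auto simp: X)
      ultimately show ?thesis using y'[OF z(1), of n] X_eq[OF z(1), of n] z(2) by simp
    qed
    moreover have "continuous_on (closure (g ` \<Omega>)) ?h" by (intro continuous_intros)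
    ultimately have "?h a \<le> 1"
      using continuous_le_on_closure[of "g ` \<Omega>" ?h a 1] cl by blast
    moreover have "(\<Sum>k<n. a ^ k * a ^ (n - k)) = (\<Sum>k<n. a ^ n)"
      by (intro sum.cong) (auto simp: power_add[symmetric])
    moreover have "norm (\<delta> * (\<Sum>k<n. a ^ n)) = \<delta> * real n"
      using a \<open>\<delta> > 0\<close> by (simp add: norm_mult norm_power)
    ultimately show ?thesis using a by simp
  qed
  moreover obtain n :: nat where "2 / \<delta> < n" using reals_Archimedean2 by blast
  hence "2 < \<delta> * real n" using \<open>\<delta> > 0\<close> by (simp add: field_simps)
  ultimately show False by (meson not_less)
qed

section \<open>Symbols that are continuous up to the boundary\<close>

lemma closure_image_eq_image_closure:
  fixes w :: "'a::t2_space \<Rightarrow> 'b::t2_space"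
  assumes "compact (closure S)" "continuous_on (closure S) w"
  shows "closure (w ` S) = w ` closure S"
proof
  show "closure (w ` S) \<subseteq> w ` closure S"
    using assms closure_subset
    by (intro closure_minimal image_mono compact_imp_closed compact_continuous_image)
  show "w ` closure S \<subseteq> closure (w ` S)"
    by (rule image_closure_subset[OF assms(2) closed_closure closure_subset])
qed

theorem corollary27:
  fixes \<Omega> :: "complex set" and w :: "complex \<Rightarrow> complex"
  assumes "\<Omega> \<noteq> {}" and "open \<Omega>" and "compact (closure \<Omega>)"
    and "w \<in> A_space \<Omega>"
    and "(INF z\<in>closure \<Omega>. norm (w z)) > 0"
  shows
    "invertible_operator_on (Hinf \<Omega>) fun_scale (Hinf_norm \<Omega>) (mult_operator (restrict0 \<Omega> w))
     \<and> (shadowing_on (Hinf \<Omega>) (Hinf_norm \<Omega>) (mult_operator (restrict0 \<Omega> w))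
          \<longleftrightarrow> (\<forall>z\<in>closure \<Omega>. norm (w z) \<noteq> 1))
     \<and> (connected \<Omega> \<longrightarrow>
          (shadowing_on (Hinf \<Omega>) (Hinf_norm \<Omega>) (mult_operator (restrict0 \<Omega> w))
           \<longleftrightarrow> hyperbolic_on (Hinf \<Omega>) fun_scale (Hinf_norm \<Omega>) (mult_operator (restrict0 \<Omega> w))))"
proof -
  let ?g = "restrict0 \<Omega> w"
  have wc: "continuous_on (closure \<Omega>) w" and wh: "w holomorphic_on \<Omega>"
    using assms(4) by (auto simp: A_space_def)
  have cl: "closure (?g ` \<Omega>) = w ` closure \<Omega>"
    using closure_image_eq_image_closure[OF assms(3) wc] by (simp add: restrict0_def)
  have g: "?g holomorphic_on \<Omega>"
    by (rule holomorphic_transform[OF wh]) (simp add: restrict0_def)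
  have bd: "bounded (?g ` \<Omega>)"
    using compact_imp_bounded[OF compact_continuous_image[OF wc assms(3)]] closure_subset
    by (metis cl bounded_subset)
  have "w z \<noteq> 0" if "z \<in> closure \<Omega>" for z
  proof -
    have "(INF z\<in>closure \<Omega>. norm (w z)) \<le> norm (w z)"
      using that by (intro cINF_lower) (auto intro!: bdd_belowI[of _ 0])
    with assms(5) show ?thesis by auto
  qed
  hence 0: "0 \<notin> closure (?g ` \<Omega>)" unfolding cl by force
  have inv: "invertible_operator_on (Hinf \<Omega>) fun_scale (Hinf_norm \<Omega>) (mult_operator ?g)"
    using 0 by (simp add: invertible_mult_operator_iff[OF assms(1) g bd])
  have shadow: "shadowing_on (Hinf \<Omega>) (Hinf_norm \<Omega>) (mult_operator ?g)
      \<longleftrightarrow> closure (?g ` \<Omega>) \<inter> {l. norm l = 1} = {}"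
    using shadowing_mult_operatorI[OF assms(1,2) g bd 0] shadowing_mult_operatorD[OF assms(1) g bd 0]
    by (auto simp: sphere_def)
  show ?thesis
    unfolding shadow hyperbolic_on_def spectrum_mult_operator[OF assms(1) g bd]
    using inv by (auto simp: cl)
qed

end
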